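(* Let $(M,g)$ be a compact Riemannian manifold without boundary and let $\{e_j\}_{j\in\mathbb N}$ be an orthonormal basis of $L^2(M)$ with $\Delta_g e_j=-\lambda_j^2e_j$, $\lambda_j\ge0$. Assume that for each eigenvalue $\lambda$ of $\sqrt{-\Delta_g}$, $$\sum_{j:\lambda_j=\lambda}|e_j(x)|^2=\frac{\#\{j:\lambda_j=\lambda\}}{|M|}\quad\text{for a.e. }x\in M.$$ Let $E$ be a measurable subset of $M$, let $S$ be a finite subset of the spectrum of $\sqrt{-\Delta_g}$, and let $X_S=\{j:\lambda_j\in S\}$. Suppose $f\in L^2(M)$, not identically $0$, is $L^2$-concentrated in $E$ at level $L$ with respect to the Riemannian volume measure, and $\widehat f$ is $L^2$-concentrated in $X_S$ at level $L'$ with respect to the counting measure. Then $$(1-\epsilon-\epsilon')^2\le\frac{|E|}{|M|}\cdot\#X_S,$$ where $L=(1-\epsilon^2)^{-1/2}$ and $L'=(1-\epsilon'^2)^{-1/2}$ with $\epsilon,\epsilon'\in[0,1)$.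
   Context: $\Delta_g$ is the Laplace–Beltrami operator (negative semi-definite sign convention), and $|E|$, $|M|$ denote Riemannian volumes. The eigenvalues $\lambda_j$ of $\sqrt{-\Delta_g}$ are listed with multiplicity, $0=\lambda_1\le\lambda_2\le\cdots\to\infty$. The Fourier coefficients of $f$ are $\widehat f(j)=\int_M f\,\overline{e_j}\,dV_g$, viewed as a function on $\mathbb N$. Concentration: if $X$ is a measure space with measure $\mu$ and $E\subset X$, a function $f\in L^p(X,\mu)$ is $L^p$-concentrated on (in) $E$ at level $L\ge1$ if $\left(\int_X|f|^p\,d\mu\right)^{1/p}\le L\left(\int_E|f|^p\,d\mu\right)^{1/p}$.
   Formalization: The hypothesis ε+ε' ≤ 1 is added; without it the claim fails, e.g. on the circle with S={0}, E a short arc with |E|/|M|=δ, f=1+1_E/√δ and ε=ε'=0.99. *)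

theory Defs
  imports "HOL-Analysis.Analysis"
begin

section \<open>Smooth maps on open subsets of Euclidean space\<close>

definition partial_derivative ::
    "'n \<Rightarrow> (real^'n \<Rightarrow> 'b) \<Rightarrow> real^'n \<Rightarrow> 'b::real_normed_vector" where
  "partial_derivative i f x = frechet_derivative f (at x) (axis i 1)"

text \<open>Intended for open \<open>U\<close> only.\<close>
primrec Ck_on :: "nat \<Rightarrow> (real^'n) set \<Rightarrow> (real^'n \<Rightarrow> 'b::real_normed_vector) \<Rightarrow> bool" where
  "Ck_on 0 U f \<longleftrightarrow> continuous_on U f"
| "Ck_on (Suc k) U f \<longleftrightarrow>
     (\<forall>x\<in>U. f differentiable (at x)) \<and> (\<forall>i. Ck_on k U (partial_derivative i f))"

definition smooth_on :: "(real^'n) set \<Rightarrow> (real^'n \<Rightarrow> 'b::real_normed_vector) \<Rightarrow> bool" where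
  "smooth_on U f \<longleftrightarrow> (\<forall>k. Ck_on k U f)"

section \<open>Closed Riemannian manifolds\<close>

text \<open>
  A chart \<open>(U, \<phi>)\<close> is an open set together with its coordinate map; values of \<open>\<phi>\<close> outside \<open>U\<close>
  are irrelevant. The dimension is \<open>CARD('n)\<close>. The metric tensor is given by its component
  matrix \<open>metric M c\<close> in each chart \<open>c\<close> of the atlas, as a function of the coordinates.
\<close>

type_synonym ('a, 'n) chart = "'a set \<times> ('a \<Rightarrow> real^'n)"

record ('a, 'n::finite) riemannian =
  mtop :: "'a topology"
  atlas :: "('a, 'n) chart set"
  metric :: "('a, 'n) chart \<Rightarrow> real^'n \<Rightarrow> real^'n^'n"

definition chart_image :: "('a, 'n::finite) chart \<Rightarrow> (real^'n) set" where
  "chart_image c = snd c ` fst c"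

definition chart_inv :: "('a, 'n::finite) chart \<Rightarrow> real^'n \<Rightarrow> 'a" where
  "chart_inv c = inv_into (fst c) (snd c)"

definition transition :: "('a, 'n::finite) chart \<Rightarrow> ('a, 'n) chart \<Rightarrow> real^'n \<Rightarrow> real^'n" where
  "transition c d = snd d \<circ> chart_inv c"

definition smooth_manifold :: "('a, 'n::finite) riemannian \<Rightarrow> bool" where
  "smooth_manifold M \<longleftrightarrow>
     Hausdorff_space (mtop M) \<and> second_countable (mtop M) \<and>
     (\<Union>c\<in>atlas M. fst c) = topspace (mtop M) \<and>
     (\<forall>c\<in>atlas M. openin (mtop M) (fst c) \<and> open (chart_image c) \<and>
        homeomorphic_map (subtopology (mtop M) (fst c)) (top_of_set (chart_image c)) (snd c)) \<and>
     (\<forall>c\<in>atlas M. \<forall>d\<in>atlas M. smooth_on (snd c ` (fst c \<inter> fst d)) (transition c d))"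

text \<open>
  The last conjunct is the transformation law \<open>g\<^sub>c = J\<^sup>T g\<^sub>d J\<close> of a \<open>(0,2)\<close>-tensor, where \<open>J\<close> is
  the Jacobian matrix of the change of coordinates from \<open>c\<close> to \<open>d\<close>.
\<close>
definition riemannian_metric :: "('a, 'n::finite) riemannian \<Rightarrow> bool" where
  "riemannian_metric M \<longleftrightarrow>
     (\<forall>c\<in>atlas M. smooth_on (chart_image c) (metric M c) \<and>
        (\<forall>x\<in>chart_image c. transpose (metric M c x) = metric M c x \<and>
           (\<forall>v. v \<noteq> 0 \<longrightarrow> v \<bullet> (metric M c x *v v) > 0))) \<and>
     (\<forall>c\<in>atlas M. \<forall>d\<in>atlas M. \<forall>x\<in>snd c ` (fst c \<inter> fst d).
        let J = jacobian (transition c d) (at x) in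
        metric M c x = transpose J ** metric M d (transition c d x) ** J)"

definition closed_riemannian_manifold :: "('a, 'n::finite) riemannian \<Rightarrow> bool" where
  "closed_riemannian_manifold M \<longleftrightarrow>
     smooth_manifold M \<and> riemannian_metric M \<and> compact_space (mtop M)"

definition smooth_function ::
    "('a, 'n::finite) riemannian \<Rightarrow> ('a \<Rightarrow> 'b::real_normed_vector) \<Rightarrow> bool" where
  "smooth_function M u \<longleftrightarrow> (\<forall>c\<in>atlas M. smooth_on (chart_image c) (u \<circ> chart_inv c))"

section \<open>Riemannian volume\<close>

text \<open>\<open>\<surd>(det g)\<close> in the coordinates of \<open>c\<close>.\<close>
definition volume_density :: "('a, 'n::finite) riemannian \<Rightarrow> ('a, 'n) chart \<Rightarrow> real^'n \<Rightarrow> real" where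
  "volume_density M c x = sqrt (det (metric M c x))"

text \<open>The Borel measure \<open>A \<mapsto> \<integral> \<surd>(det g) dx\<close> over \<open>\<phi>(A \<inter> U)\<close>, for \<open>c = (U, \<phi>)\<close>.\<close>
definition chart_volume :: "('a, 'n::finite) riemannian \<Rightarrow> ('a, 'n) chart \<Rightarrow> 'a measure" where
  "chart_volume M c =
     distr (density (restrict_space lborel (chart_image c)) (\<lambda>x. ennreal (volume_density M c x)))
       (sigma (topspace (mtop M)) {U. openin (mtop M) U}) (chart_inv c)"

text \<open>
  By the change of variables formula any two chart volumes agree on the overlap of their
  domains, so their supremum (in the lattice of Borel measures) is the unique Borel measure
  which restricts to \<open>chart_volume M c\<close> on the domain of each chart \<open>c\<close>. Completing it makes
  Lebesgue measurable sets and functions on the manifold measurable.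
\<close>
definition riemannian_volume :: "('a, 'n::finite) riemannian \<Rightarrow> 'a measure" where
  "riemannian_volume M = completion (SUP c\<in>atlas M. chart_volume M c)"

section \<open>Laplace--Beltrami operator\<close>

text \<open>
  \<open>\<Delta> u = 1/\<surd>(det g) \<Sum>\<^sub>i \<Sum>\<^sub>j \<partial>\<^sub>i (\<surd>(det g) g\<^sup>i\<^sup>j \<partial>\<^sub>j u)\<close>, which for smooth \<open>u\<close> does not depend
  on the chart.
\<close>
definition chart_laplacian ::
    "('a, 'n::finite) riemannian \<Rightarrow> ('a, 'n) chart \<Rightarrow> ('a \<Rightarrow> complex) \<Rightarrow> real^'n \<Rightarrow> complex" where
  "chart_laplacian M c u x =
     (\<Sum>i\<in>UNIV. \<Sum>j\<in>UNIV.
        partial_derivative i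
          (\<lambda>y. (volume_density M c y * matrix_inv (metric M c y) $ i $ j) *\<^sub>R
               partial_derivative j (u \<circ> chart_inv c) y) x) /\<^sub>R volume_density M c x"

definition laplace_beltrami ::
    "('a, 'n::finite) riemannian \<Rightarrow> ('a \<Rightarrow> complex) \<Rightarrow> 'a \<Rightarrow> complex" where
  "laplace_beltrami M u p =
     (let c = (SOME c. c \<in> atlas M \<and> p \<in> fst c) in chart_laplacian M c u (snd c p))"

section \<open>Lebesgue spaces, orthonormal bases, concentration\<close>

text \<open>Elements of \<open>L\<^sup>p\<close> are represented by functions, equality being equality almost everywhere.\<close>
definition Lp :: "real \<Rightarrow> 'a measure \<Rightarrow> ('a \<Rightarrow> complex) set" where
  "Lp p \<mu> = {f \<in> borel_measurable \<mu>. integrable \<mu> (\<lambda>x. cmod (f x) powr p)}"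

definition L2_inner :: "'a measure \<Rightarrow> ('a \<Rightarrow> complex) \<Rightarrow> ('a \<Rightarrow> complex) \<Rightarrow> complex" where
  "L2_inner \<mu> f g = (\<integral>x. f x * cnj (g x) \<partial>\<mu>)"

text \<open>An orthonormal sequence in \<open>L\<^sup>2\<close> whose linear span is dense.\<close>
definition L2_orthonormal_basis :: "'a measure \<Rightarrow> (nat \<Rightarrow> 'a \<Rightarrow> complex) \<Rightarrow> bool" where
  "L2_orthonormal_basis \<mu> e \<longleftrightarrow>
     (\<forall>j. e j \<in> Lp 2 \<mu>) \<and>
     (\<forall>i j. L2_inner \<mu> (e i) (e j) = (if i = j then 1 else 0)) \<and>
     (\<forall>f\<in>Lp 2 \<mu>. \<forall>\<delta>>0. \<exists>N c. (\<integral>x. (cmod (f x - (\<Sum>j<N. c j * e j x)))\<^sup>2 \<partial>\<mu>) < \<delta>)"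

definition fourier_coeff ::
    "'a measure \<Rightarrow> (nat \<Rightarrow> 'a \<Rightarrow> complex) \<Rightarrow> ('a \<Rightarrow> complex) \<Rightarrow> nat \<Rightarrow> complex" where
  "fourier_coeff \<mu> e f j = L2_inner \<mu> f (e j)"

definition Lp_concentrated ::
    "real \<Rightarrow> 'a measure \<Rightarrow> 'a set \<Rightarrow> real \<Rightarrow> ('a \<Rightarrow> complex) \<Rightarrow> bool" where
  "Lp_concentrated p \<mu> E L f \<longleftrightarrow>
     f \<in> Lp p \<mu> \<and> E \<in> sets \<mu> \<and> L \<ge> 1 \<and>
     (\<integral>x. cmod (f x) powr p \<partial>\<mu>) powr (1/p) \<le> L * (LINT x:E|\<mu>. cmod (f x) powr p) powr (1/p)"

section \<open>Eigenfunctions and spectrum\<close>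

text \<open>
  The equation \<open>\<Delta> u = - l\<^sup>2 u\<close> for an element \<open>u\<close> of \<open>L\<^sup>2\<close>. By elliptic regularity a solution
  has a smooth representative, for which the equation holds pointwise.
\<close>
definition laplace_eigenfunction ::
    "('a, 'n::finite) riemannian \<Rightarrow> real \<Rightarrow> ('a \<Rightarrow> complex) \<Rightarrow> bool" where
  "laplace_eigenfunction M l u \<longleftrightarrow>
     u \<in> Lp 2 (riemannian_volume M) \<and>
     (\<exists>v. smooth_function M v \<and> (AE x in riemannian_volume M. u x = v x) \<and>
          (\<forall>p\<in>topspace (mtop M). laplace_beltrami M v p = - (complex_of_real (l\<^sup>2) * v p)))"

text \<open>The spectrum of \<open>\<surd>(-\<Delta>)\<close>; on a closed manifold it consists of eigenvalues only.\<close>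
definition sqrt_laplace_spectrum :: "('a, 'n::finite) riemannian \<Rightarrow> real set" where
  "sqrt_laplace_spectrum M =
     {l. l \<ge> 0 \<and> (\<exists>u. laplace_eigenfunction M l u \<and> \<not> (AE x in riemannian_volume M. u x = 0))}"

end

theory Submission
  imports Defs
begin

text \<open>
  Let \<open>P f\<close> be the part of the Fourier expansion of \<open>f\<close> with frequencies in \<open>X\<^sub>S\<close>. Concentration
  of \<open>f\<close> gives \<open>\<parallel>1\<^sub>E f\<parallel> \<ge> (1 - \<epsilon>) \<parallel>f\<parallel>\<close>; concentration of the Fourier coefficients and
  Parseval give \<open>\<parallel>f - P f\<parallel> \<le> \<epsilon>' \<parallel>f\<parallel>\<close>. Hence \<open>(1 - \<epsilon> - \<epsilon>') \<parallel>f\<parallel> \<le> \<parallel>1\<^sub>E P f\<parallel>\<close>. By Cauchy--Schwarz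
  and Bessel \<open>\<bar>P f\<bar>\<^sup>2 \<le> \<parallel>f\<parallel>\<^sup>2 \<Sum>\<^sub>j\<^sub>\<in>\<^sub>X\<^sub>S \<bar>e\<^sub>j\<bar>\<^sup>2\<close>, and the last sum is almost everywhere the
  constant \<open>#X\<^sub>S / |M|\<close>.
\<close>

section \<open>Square-integrable functions\<close>

lemma Lp_2_iff:
  "f \<in> Lp 2 \<mu> \<longleftrightarrow> f \<in> borel_measurable \<mu> \<and> integrable \<mu> (\<lambda>x. (cmod (f x))\<^sup>2)"
  by (simp add: Lp_def)

lemma Lp_2_measurable: "f \<in> Lp 2 \<mu> \<Longrightarrow> f \<in> borel_measurable \<mu>"
  and Lp_2_integrable: "f \<in> Lp 2 \<mu> \<Longrightarrow> integrable \<mu> (\<lambda>x. (cmod (f x))\<^sup>2)"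
  by (simp_all add: Lp_2_iff)

lemma Lp_2_scale: "f \<in> Lp 2 \<mu> \<Longrightarrow> (\<lambda>x. c * f x) \<in> Lp 2 \<mu>"
  by (auto simp: Lp_2_iff norm_mult power_mult_distrib)

lemma Lp_2_add:
  assumes "f \<in> Lp 2 \<mu>" "g \<in> Lp 2 \<mu>"
  shows "(\<lambda>x. f x + g x) \<in> Lp 2 \<mu>"
proof -
  note [measurable] = assms[THEN Lp_2_measurable]
  have "(cmod (f x + g x))\<^sup>2 \<le> 2 * (cmod (f x))\<^sup>2 + 2 * (cmod (g x))\<^sup>2" for x
  proof -
    have "(cmod (f x + g x))\<^sup>2 \<le> (cmod (f x) + cmod (g x))\<^sup>2"
      by (intro power_mono norm_triangle_ineq) auto
    also have "\<dots> \<le> 2 * (cmod (f x))\<^sup>2 + 2 * (cmod (g x))\<^sup>2"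
      using sum_squares_bound[of "cmod (f x)" "cmod (g x)"] by (simp add: power2_sum)
    finally show ?thesis .
  qed
  moreover have "integrable \<mu> (\<lambda>x. 2 * (cmod (f x))\<^sup>2 + 2 * (cmod (g x))\<^sup>2)"
    using assms by (auto simp: Lp_2_iff)
  ultimately have "integrable \<mu> (\<lambda>x. (cmod (f x + g x))\<^sup>2)"
    by (elim Bochner_Integration.integrable_bound) auto
  then show ?thesis by (simp add: Lp_2_iff)
qed

lemma Lp_2_diff:
  assumes "f \<in> Lp 2 \<mu>" "g \<in> Lp 2 \<mu>"
  shows "(\<lambda>x. f x - g x) \<in> Lp 2 \<mu>"
  using Lp_2_add[OF assms(1) Lp_2_scale[OF assms(2), of "-1"]] by simp

lemma Lp_2_sum:
  assumes "\<And>j. j \<in> X \<Longrightarrow> f j \<in> Lp 2 \<mu>"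
  shows "(\<lambda>x. \<Sum>j\<in>X. f j x) \<in> Lp 2 \<mu>"
  using assms
proof (induction X rule: infinite_finite_induct)
  case (insert j X)
  then show ?case using Lp_2_add[of "f j" \<mu> "\<lambda>x. \<Sum>j\<in>X. f j x"] by simp
qed (auto simp: Lp_2_iff)

lemma Lp_2_indicator:
  assumes "f \<in> Lp 2 \<mu>" "E \<in> sets \<mu>"
  shows "(\<lambda>x. indicator E x * f x) \<in> Lp 2 \<mu>"
proof -
  note [measurable] = assms(1)[THEN Lp_2_measurable] assms(2)
  have "integrable \<mu> (\<lambda>x. (cmod (indicator E x * f x))\<^sup>2)"
    by (rule Bochner_Integration.integrable_bound[OF Lp_2_integrable[OF assms(1)]])
      (auto simp: indicator_def)
  then show ?thesis by (simp add: Lp_2_iff)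
qed

text \<open>The product is dominated by \<open>|f|^2 + |g|^2\<close>. This makes
  \<open>L2_inner\<close> additive in both arguments, since the Bochner integral of a non-integrable
  function is 0 by default.\<close>

lemma integrable_mult_cnj:
  assumes "f \<in> Lp 2 \<mu>" "g \<in> Lp 2 \<mu>"
  shows "integrable \<mu> (\<lambda>x. f x * cnj (g x))"
proof (rule Bochner_Integration.integrable_bound)
  note [measurable] = assms[THEN Lp_2_measurable]
  show "integrable \<mu> (\<lambda>x. (cmod (f x))\<^sup>2 + (cmod (g x))\<^sup>2)"
    using assms by (auto simp: Lp_2_iff)
  show "(\<lambda>x. f x * cnj (g x)) \<in> borel_measurable \<mu>"
    by (intro borel_measurable_times borel_measurable_continuous_on[where f = cnj] continuous_on_cnj
        continuous_on_id) measurable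
  show "AE x in \<mu>. norm (f x * cnj (g x)) \<le> norm ((cmod (f x))\<^sup>2 + (cmod (g x))\<^sup>2)"
  proof (intro always_eventually allI)
    fix x
    have "2 * cmod (f x) * cmod (g x) \<le> (cmod (f x))\<^sup>2 + (cmod (g x))\<^sup>2"
      by (rule sum_squares_bound)
    moreover have "0 \<le> cmod (f x) * cmod (g x)" by simp
    ultimately have "cmod (f x) * cmod (g x) \<le> (cmod (f x))\<^sup>2 + (cmod (g x))\<^sup>2"
      by linarith
    then show "norm (f x * cnj (g x)) \<le> norm ((cmod (f x))\<^sup>2 + (cmod (g x))\<^sup>2)"
      by (simp add: norm_mult)
  qed
qed

section \<open>Inner product and norm on square-integrable functions\<close>

lemma L2_inner_self: "L2_inner \<mu> f f = complex_of_real (\<integral>x. (cmod (f x))\<^sup>2 \<partial>\<mu>)"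
  by (simp add: L2_inner_def complex_norm_square[symmetric] integral_complex_of_real[symmetric] del: integral_complex_of_real)

lemma L2_inner_cnj: "cnj (L2_inner \<mu> f g) = L2_inner \<mu> g f"
  by (simp add: L2_inner_def mult.commute flip: Bochner_Integration.integral_cnj)

lemma L2_inner_diff_left:
  assumes "f \<in> Lp 2 \<mu>" "g \<in> Lp 2 \<mu>" "h \<in> Lp 2 \<mu>"
  shows "L2_inner \<mu> (\<lambda>x. f x - g x) h = L2_inner \<mu> f h - L2_inner \<mu> g h"
  using assms by (simp add: L2_inner_def left_diff_distrib integrable_mult_cnj)

lemma L2_inner_diff_right:
  assumes "f \<in> Lp 2 \<mu>" "g \<in> Lp 2 \<mu>" "h \<in> Lp 2 \<mu>"
  shows "L2_inner \<mu> h (\<lambda>x. f x - g x) = L2_inner \<mu> h f - L2_inner \<mu> h g"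
  using assms by (simp add: L2_inner_def right_diff_distrib integrable_mult_cnj)

lemma L2_inner_sum_left:
  assumes "\<And>j. j \<in> X \<Longrightarrow> e j \<in> Lp 2 \<mu>" "h \<in> Lp 2 \<mu>"
  shows "L2_inner \<mu> (\<lambda>x. \<Sum>j\<in>X. c j * e j x) h = (\<Sum>j\<in>X. c j * L2_inner \<mu> (e j) h)"
  using assms by (simp add: L2_inner_def sum_distrib_right mult.assoc integrable_mult_cnj)

text \<open>Based on \<open>(u + v)\<^sup>2 \<le> (1 + b/a) u\<^sup>2 + (1 + a/b) v\<^sup>2\<close> with \<open>a\<close>, \<open>b\<close> the two norms.\<close>
lemma L2_triangle:
  assumes f: "f \<in> Lp 2 \<mu>" and g: "g \<in> Lp 2 \<mu>"
  shows "sqrt (\<integral>x. (cmod (f x + g x))\<^sup>2 \<partial>\<mu>)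
    \<le> sqrt (\<integral>x. (cmod (f x))\<^sup>2 \<partial>\<mu>) + sqrt (\<integral>x. (cmod (g x))\<^sup>2 \<partial>\<mu>)"
proof -
  note [measurable] = f[THEN Lp_2_measurable] g[THEN Lp_2_measurable]
  define a b where "a = sqrt (\<integral>x. (cmod (f x))\<^sup>2 \<partial>\<mu>)" and "b = sqrt (\<integral>x. (cmod (g x))\<^sup>2 \<partial>\<mu>)"
  have sq: "(\<integral>x. (cmod (f x))\<^sup>2 \<partial>\<mu>) = a\<^sup>2" "(\<integral>x. (cmod (g x))\<^sup>2 \<partial>\<mu>) = b\<^sup>2"
    by (simp_all add: a_def b_def)
  have "a \<ge> 0" "b \<ge> 0" by (simp_all add: a_def b_def)
  \<comment> \<open>The weights \<open>b/a\<close> and \<open>a/b\<close> need both norms positive;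
    if one norm is 0, that function vanishes almost everywhere.\<close>
  then consider "a = 0" | "b = 0" | "a > 0" "b > 0" by linarith
  then show ?thesis
  proof cases
    case 1
    then have "AE x in \<mu>. (cmod (f x))\<^sup>2 = 0"
      using sq integral_nonneg_eq_0_iff_AE[OF Lp_2_integrable[OF f]] by simp
    then have "(\<integral>x. (cmod (f x + g x))\<^sup>2 \<partial>\<mu>) = (\<integral>x. (cmod (g x))\<^sup>2 \<partial>\<mu>)"
      by (intro integral_cong_AE) auto
    then show ?thesis by simp
  next
    case 2
    then have "AE x in \<mu>. (cmod (g x))\<^sup>2 = 0"
      using sq integral_nonneg_eq_0_iff_AE[OF Lp_2_integrable[OF g]] by simp
    then have "(\<integral>x. (cmod (f x + g x))\<^sup>2 \<partial>\<mu>) = (\<integral>x. (cmod (f x))\<^sup>2 \<partial>\<mu>)"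
      by (intro integral_cong_AE) auto
    then show ?thesis by simp
  next
    case 3
    have pw: "(cmod (f x + g x))\<^sup>2 \<le> (1 + b / a) * (cmod (f x))\<^sup>2 + (1 + a / b) * (cmod (g x))\<^sup>2" for x
    proof -
      let ?u = "cmod (f x)" and ?v = "cmod (g x)"
      have "0 \<le> (b * ?u - a * ?v)\<^sup>2 / (a * b)" using 3 by simp
      also have "\<dots> = b / a * ?u\<^sup>2 + a / b * ?v\<^sup>2 - 2 * ?u * ?v"
        using 3 by (simp add: field_simps power2_eq_square)
      finally have "(?u + ?v)\<^sup>2 \<le> (1 + b / a) * ?u\<^sup>2 + (1 + a / b) * ?v\<^sup>2"
        by (simp add: power2_sum distrib_right)
      moreover have "(cmod (f x + g x))\<^sup>2 \<le> (?u + ?v)\<^sup>2"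
        by (intro power_mono norm_triangle_ineq) auto
      ultimately show ?thesis by linarith
    qed
    have "(\<integral>x. (cmod (f x + g x))\<^sup>2 \<partial>\<mu>)
        \<le> (\<integral>x. (1 + b / a) * (cmod (f x))\<^sup>2 + (1 + a / b) * (cmod (g x))\<^sup>2 \<partial>\<mu>)"
      using f g Lp_2_add[OF f g] pw
      by (intro integral_mono) (auto simp: Lp_2_iff)
    also have "\<dots> = (1 + b / a) * a\<^sup>2 + (1 + a / b) * b\<^sup>2"
      using f g by (simp add: Lp_2_iff sq)
    \<comment> \<open>The weights are chosen so that each of the two mixed terms is exactly
      \<open>a * b\<close>.\<close>
    also have "\<dots> = (a + b)\<^sup>2"
      using 3 by (simp add: field_simps power2_eq_square)
    finally show ?thesis
      using \<open>a \<ge> 0\<close> \<open>b \<ge> 0\<close> unfolding a_def[symmetric] b_def[symmetric]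
      by (intro real_le_lsqrt) auto
  qed
qed

text \<open>The squared form of concentration, with the level solved for \<epsilon>. The set
  integral becomes multiplication by the indicator, so that the \<open>Lp 2\<close> lemmas apply. It
  serves both \<open>f\<close> and its coefficient sequence.\<close>

lemma Lp_2_concentratedD:
  assumes "Lp_concentrated 2 \<mu> E ((1 - \<epsilon>\<^sup>2) powr (-1/2)) f" "0 \<le> \<epsilon>" "\<epsilon> < 1"
  shows "(1 - \<epsilon>\<^sup>2) * (\<integral>x. (cmod (f x))\<^sup>2 \<partial>\<mu>) \<le> (\<integral>x. (cmod (indicator E x * f x))\<^sup>2 \<partial>\<mu>)"
proof -
  define A B where "A = (\<integral>x. (cmod (f x))\<^sup>2 \<partial>\<mu>)"
    and "B = (\<integral>x. (cmod (indicator E x * f x))\<^sup>2 \<partial>\<mu>)"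
  have "A \<ge> 0" "B \<ge> 0" by (simp_all add: A_def B_def)
  have pos: "1 - \<epsilon>\<^sup>2 > 0"
    using assms(2,3) by (simp add: abs_square_less_1)
  have "(LINT x:E|\<mu>. (cmod (f x))\<^sup>2) = B"
    unfolding B_def set_lebesgue_integral_def
    by (intro Bochner_Integration.integral_cong) (auto simp: indicator_def)
  then have "A powr (1/2) \<le> (1 - \<epsilon>\<^sup>2) powr (-1/2) * B powr (1/2)"
    using assms(1) by (simp add: Lp_concentrated_def A_def)
  then have "sqrt A \<le> sqrt B / sqrt (1 - \<epsilon>\<^sup>2)"
    using pos \<open>A \<ge> 0\<close> \<open>B \<ge> 0\<close> by (simp add: powr_minus_divide powr_half_sqrt)
  then have "sqrt (1 - \<epsilon>\<^sup>2) * sqrt A \<le> sqrt B"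
    using pos by (simp add: field_simps)
  then show ?thesis
    unfolding A_def[symmetric] B_def[symmetric] by (simp add: real_sqrt_mult[symmetric])
qed

section \<open>Fourier expansions\<close>

text \<open>Separates the Hilbert space argument from the geometry: any measure with an orthonormal
  basis will do.\<close>

locale L2_basis =
  fixes \<mu> :: "'a measure" and e :: "nat \<Rightarrow> 'a \<Rightarrow> complex"
  assumes basis: "L2_orthonormal_basis \<mu> e"
begin

abbreviation "coef \<equiv> fourier_coeff \<mu> e"

lemma basis_Lp: "e j \<in> Lp 2 \<mu>"
  using basis by (simp add: L2_orthonormal_basis_def)

lemma L2_inner_basis: "L2_inner \<mu> (e i) (e j) = (if i = j then 1 else 0)"
  using basis by (simp add: L2_orthonormal_basis_def)

lemma combination_Lp: "(\<lambda>x. \<Sum>j\<in>X. c j * e j x) \<in> Lp 2 \<mu>"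
  by (intro Lp_2_sum Lp_2_scale basis_Lp)

text \<open>Expand by orthonormality and complete the square in each \<open>c j\<close>. Taking
  \<open>c = coef f\<close> gives the distance to the projection; free \<open>c\<close> lets the
  density of the span yield Parseval.\<close>

lemma norm_diff_combination:
  assumes f: "f \<in> Lp 2 \<mu>" and X: "finite X"
  shows "(\<integral>x. (cmod (f x - (\<Sum>j\<in>X. c j * e j x)))\<^sup>2 \<partial>\<mu>)
    = (\<integral>x. (cmod (f x))\<^sup>2 \<partial>\<mu>) - (\<Sum>j\<in>X. (cmod (coef f j))\<^sup>2) + (\<Sum>j\<in>X. (cmod (c j - coef f j))\<^sup>2)"
proof -
  let ?g = "\<lambda>x. \<Sum>j\<in>X. c j * e j x"
  have g: "?g \<in> Lp 2 \<mu>" by (rule combination_Lp)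
  have gh: "L2_inner \<mu> ?g h = (\<Sum>j\<in>X. c j * cnj (coef h j))" if "h \<in> Lp 2 \<mu>" for h
    using that by (simp add: L2_inner_sum_left basis_Lp fourier_coeff_def L2_inner_cnj)
  have coeff_g: "coef ?g j = c j" if "j \<in> X" for j
    using that X
    by (simp add: fourier_coeff_def L2_inner_sum_left basis_Lp L2_inner_basis if_distrib sum.delta cong: if_cong)
  have fg: "L2_inner \<mu> f ?g = (\<Sum>j\<in>X. cnj (c j) * coef f j)"
    using gh[OF f] L2_inner_cnj[of \<mu> ?g f] by simp
  have gg: "L2_inner \<mu> ?g ?g = (\<Sum>j\<in>X. c j * cnj (c j))"
    using gh[OF g] coeff_g by simp
  \<comment> \<open>The identity is computed in the complex numbers, where the inner product lives,
    and pulled back by injectivity of the embedding.\<close>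
  have "complex_of_real (\<integral>x. (cmod (f x - ?g x))\<^sup>2 \<partial>\<mu>) = L2_inner \<mu> (\<lambda>x. f x - ?g x) (\<lambda>x. f x - ?g x)"
    by (simp only: L2_inner_self)
  also have "\<dots> = L2_inner \<mu> f f - L2_inner \<mu> f ?g - (L2_inner \<mu> ?g f - L2_inner \<mu> ?g ?g)"
    using L2_inner_diff_left[OF f g Lp_2_diff[OF f g]] L2_inner_diff_right[OF f g f]
      L2_inner_diff_right[OF f g g] by simp
  also have "\<dots> = L2_inner \<mu> f f - (\<Sum>j\<in>X. coef f j * cnj (coef f j))
      + (\<Sum>j\<in>X. (c j - coef f j) * cnj (c j - coef f j))"
    unfolding fg gg gh[OF f]
    by (simp add: sum_subtractf[symmetric] sum.distrib[symmetric] algebra_simps)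
  also have "\<dots> = complex_of_real ((\<integral>x. (cmod (f x))\<^sup>2 \<partial>\<mu>) - (\<Sum>j\<in>X. (cmod (coef f j))\<^sup>2)
      + (\<Sum>j\<in>X. (cmod (c j - coef f j))\<^sup>2))"
    by (simp only: L2_inner_self complex_norm_square[symmetric] of_real_add of_real_diff of_real_sum of_real_power)
  finally show ?thesis by (simp only: of_real_eq_iff)
qed

lemma norm_diff_projection:
  assumes "f \<in> Lp 2 \<mu>" "finite X"
  shows "(\<integral>x. (cmod (f x - (\<Sum>j\<in>X. coef f j * e j x)))\<^sup>2 \<partial>\<mu>)
    = (\<integral>x. (cmod (f x))\<^sup>2 \<partial>\<mu>) - (\<Sum>j\<in>X. (cmod (coef f j))\<^sup>2)"
  using norm_diff_combination[OF assms, of "coef f"] by simp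

text \<open>The difference of the two sides is the squared distance from \<open>f\<close> to its
  projection.\<close>

lemma bessel:
  assumes "f \<in> Lp 2 \<mu>" "finite X"
  shows "(\<Sum>j\<in>X. (cmod (coef f j))\<^sup>2) \<le> (\<integral>x. (cmod (f x))\<^sup>2 \<partial>\<mu>)"
proof -
  have "0 \<le> (\<integral>x. (cmod (f x - (\<Sum>j\<in>X. coef f j * e j x)))\<^sup>2 \<partial>\<mu>)" by simp
  then show ?thesis unfolding norm_diff_projection[OF assms] by simp
qed

text \<open>Density gives a finite combination within \<delta> of \<open>f\<close> in squared norm;
  replacing its coefficients by those of \<open>f\<close> only improves the approximation. Square
  summability ensures that the right-hand integral is the true sum of the series and not the default
  0.\<close>

lemma parseval_le:
  assumes f: "f \<in> Lp 2 \<mu>" and coeff: "coef f \<in> Lp 2 (count_space UNIV)"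
  shows "(\<integral>x. (cmod (f x))\<^sup>2 \<partial>\<mu>) \<le> (\<integral>j. (cmod (coef f j))\<^sup>2 \<partial>count_space UNIV)"
proof (rule field_le_epsilon)
  fix \<delta> :: real assume "\<delta> > 0"
  then obtain N c where N: "(\<integral>x. (cmod (f x - (\<Sum>j<N. c j * e j x)))\<^sup>2 \<partial>\<mu>) < \<delta>"
    using basis f unfolding L2_orthonormal_basis_def by blast
  have "0 \<le> (\<Sum>j<N. (cmod (c j - coef f j))\<^sup>2)" by (intro sum_nonneg) simp
  then have "(\<integral>x. (cmod (f x))\<^sup>2 \<partial>\<mu>) \<le> (\<Sum>j<N. (cmod (coef f j))\<^sup>2) + \<delta>"
    using N norm_diff_combination[OF f, of "{..<N}" c] by simp
  moreover have int: "integrable (count_space UNIV) (\<lambda>j. (cmod (coef f j))\<^sup>2)"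
    using coeff by (rule Lp_2_integrable)
  have "(\<Sum>j<N. (cmod (coef f j))\<^sup>2) \<le> (\<integral>j. (cmod (coef f j))\<^sup>2 \<partial>count_space UNIV)"
    using int unfolding integrable_count_space_nat_iff
    by (subst integral_count_space_nat[OF int]) (intro sum_le_suminf, auto)
  ultimately show "(\<integral>x. (cmod (f x))\<^sup>2 \<partial>\<mu>) \<le> (\<integral>j. (cmod (coef f j))\<^sup>2 \<partial>count_space UNIV) + \<delta>"
    by linarith
qed

text \<open>By Parseval, concentration says that the coefficients in \<open>X\<close> carry at least
  the fraction \<open>1 - \<epsilon>^2\<close> of the squared norm of \<open>f\<close>; the squared
  distance to the projection is what remains.\<close>

lemma norm_diff_projection_concentrated:
  assumes f: "f \<in> Lp 2 \<mu>" and X: "finite X" and \<epsilon>: "0 \<le> \<epsilon>" "\<epsilon> < 1"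
    and conc: "Lp_concentrated 2 (count_space UNIV) X ((1 - \<epsilon>\<^sup>2) powr (-1/2)) (coef f)"
  shows "(\<integral>x. (cmod (f x - (\<Sum>j\<in>X. coef f j * e j x)))\<^sup>2 \<partial>\<mu>) \<le> \<epsilon>\<^sup>2 * (\<integral>x. (cmod (f x))\<^sup>2 \<partial>\<mu>)"
proof -
  have "\<epsilon>\<^sup>2 \<le> 1" using \<epsilon> by (simp add: abs_square_le_1)
  \<comment> \<open>Square summability is part of the concentration predicate, so Bessel need not be
    passed to the limit.\<close>
  moreover have "coef f \<in> Lp 2 (count_space UNIV)"
    using conc by (simp add: Lp_concentrated_def)
  ultimately have "(1 - \<epsilon>\<^sup>2) * (\<integral>x. (cmod (f x))\<^sup>2 \<partial>\<mu>)
      \<le> (1 - \<epsilon>\<^sup>2) * (\<integral>j. (cmod (coef f j))\<^sup>2 \<partial>count_space UNIV)"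
    by (intro mult_left_mono parseval_le[OF f]) auto
  also have "\<dots> \<le> (\<integral>j. (cmod (indicator X j * coef f j))\<^sup>2 \<partial>count_space UNIV)"
    using conc \<epsilon> by (rule Lp_2_concentratedD)
  also have "\<dots> = (\<Sum>j\<in>X. (cmod (coef f j))\<^sup>2)"
  proof -
    have "{j. indicator X j * coef f j \<noteq> 0} \<subseteq> X" by (auto simp: indicator_def)
    from finite_subset[OF this X] show ?thesis
      using X by (subst lebesgue_integral_count_space_finite_support)
        (auto simp: indicator_def intro!: sum.mono_neutral_cong_left)
  qed
  finally show ?thesis
    unfolding norm_diff_projection[OF f X] by (simp add: left_diff_distrib)
qed

text \<open>A bound on the squared modulus of the projection by a constant, integrated over
  \<open>E\<close>; finite measure of \<open>E\<close> makes the constant integrable there.\<close>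

lemma norm_projection_bound:
  assumes f: "f \<in> Lp 2 \<mu>" and X: "finite X" and E: "E \<in> sets \<mu>" "emeasure \<mu> E < \<infinity>"
    and K: "AE x in \<mu>. (\<Sum>j\<in>X. (cmod (e j x))\<^sup>2) \<le> K"
  shows "(\<integral>x. (cmod (indicator E x * (\<Sum>j\<in>X. coef f j * e j x)))\<^sup>2 \<partial>\<mu>)
    \<le> measure \<mu> E * K * (\<integral>x. (cmod (f x))\<^sup>2 \<partial>\<mu>)"
proof -
  let ?P = "\<lambda>x. \<Sum>j\<in>X. coef f j * e j x"
  let ?A = "\<integral>x. (cmod (f x))\<^sup>2 \<partial>\<mu>"
  have pw: "(cmod (?P x))\<^sup>2 \<le> ?A * (\<Sum>j\<in>X. (cmod (e j x))\<^sup>2)" for x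
  proof -
    have "(cmod (?P x))\<^sup>2 \<le> (\<Sum>j\<in>X. cmod (coef f j) * cmod (e j x))\<^sup>2"
      by (intro power_mono order_trans[OF norm_sum]) (auto simp: norm_mult)
    also have "\<dots> \<le> (\<Sum>j\<in>X. (cmod (coef f j))\<^sup>2) * (\<Sum>j\<in>X. (cmod (e j x))\<^sup>2)"
      by (rule Cauchy_Schwarz_ineq_sum)
    also have "\<dots> \<le> ?A * (\<Sum>j\<in>X. (cmod (e j x))\<^sup>2)"
      by (intro mult_right_mono bessel[OF f X] sum_nonneg) auto
    finally show ?thesis .
  qed
  have "(\<integral>x. (cmod (indicator E x * ?P x))\<^sup>2 \<partial>\<mu>) \<le> (\<integral>x. indicator E x *\<^sub>R (K * ?A) \<partial>\<mu>)"
  proof (rule integral_mono_AE)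
    show "integrable \<mu> (\<lambda>x. (cmod (indicator E x * ?P x))\<^sup>2)"
      by (intro Lp_2_integrable Lp_2_indicator combination_Lp E)
    show "integrable \<mu> (\<lambda>x. indicator E x *\<^sub>R (K * ?A))"
      using E by (intro integrable_scaleR_left integrable_real_indicator)
    show "AE x in \<mu>. (cmod (indicator E x * ?P x))\<^sup>2 \<le> indicator E x *\<^sub>R (K * ?A)"
      using K
    proof eventually_elim
      case (elim x)
      have "?A * (\<Sum>j\<in>X. (cmod (e j x))\<^sup>2) \<le> ?A * K"
        using elim by (intro mult_left_mono) auto
      then have "(cmod (?P x))\<^sup>2 \<le> K * ?A" using pw[of x] by (simp add: mult.commute)
      then show ?case by (auto simp: indicator_def)
    qed
  qed
  also have "\<dots> = measure \<mu> E * K * ?A"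
    using E by (simp add: mult.assoc)
  finally show ?thesis .
qed

text \<open>The abstract inequality: the basis enters the bound only through an almost everywhere
  bound \<open>K\<close> on the sum of squares over \<open>X\<close>.\<close>

theorem uncertainty_principle:
  assumes f: "f \<in> Lp 2 \<mu>" "\<not> (AE x in \<mu>. f x = 0)"
    and X: "finite X" and E: "E \<in> sets \<mu>" "emeasure \<mu> E < \<infinity>"
    and K: "AE x in \<mu>. (\<Sum>j\<in>X. (cmod (e j x))\<^sup>2) \<le> K"
    and \<epsilon>: "0 \<le> \<epsilon>" "\<epsilon> < 1" "0 \<le> \<epsilon>'" "\<epsilon>' < 1" "\<epsilon> + \<epsilon>' \<le> 1"
    and concE: "Lp_concentrated 2 \<mu> E ((1 - \<epsilon>\<^sup>2) powr (-1/2)) f"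
    and concX: "Lp_concentrated 2 (count_space UNIV) X ((1 - \<epsilon>'\<^sup>2) powr (-1/2)) (coef f)"
  shows "(1 - \<epsilon> - \<epsilon>')\<^sup>2 \<le> measure \<mu> E * K"
proof -
  let ?P = "\<lambda>x. \<Sum>j\<in>X. coef f j * e j x"
  define A where "A = (\<integral>x. (cmod (f x))\<^sup>2 \<partial>\<mu>)"
  have "A \<noteq> 0"
    using f(2) integral_nonneg_eq_0_iff_AE[OF Lp_2_integrable[OF f(1)]] by (auto simp: A_def)
  moreover have "A \<ge> 0" by (simp add: A_def)
  ultimately have "A > 0" by linarith
  have P: "?P \<in> Lp 2 \<mu>" by (rule combination_Lp)
  note d = Lp_2_diff[OF f(1) P]
  \<comment> \<open>Weakens the factor \<open>sqrt (1 - \<epsilon>^2)\<close> to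
    \<open>1 - \<epsilon>\<close>, so that both errors enter linearly.\<close>
  have "(1 - \<epsilon>)\<^sup>2 \<le> (1 - \<epsilon>) * (1 + \<epsilon>)"
    using \<epsilon> unfolding power2_eq_square by (intro mult_left_mono) auto
  then have "(1 - \<epsilon>)\<^sup>2 \<le> 1 - \<epsilon>\<^sup>2"
    by (simp add: algebra_simps power2_eq_square)
  then have "(1 - \<epsilon>)\<^sup>2 * A \<le> (1 - \<epsilon>\<^sup>2) * A"
    using \<open>A > 0\<close> by (intro mult_right_mono) auto
  also have "\<dots> \<le> (\<integral>x. (cmod (indicator E x * f x))\<^sup>2 \<partial>\<mu>)"
    unfolding A_def using concE \<epsilon> by (intro Lp_2_concentratedD) auto
  finally have "(1 - \<epsilon>) * sqrt A \<le> sqrt (\<integral>x. (cmod (indicator E x * f x))\<^sup>2 \<partial>\<mu>)"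
    using \<epsilon> \<open>A > 0\<close> by (intro real_le_rsqrt) (simp add: power_mult_distrib)
  also have "\<dots> = sqrt (\<integral>x. (cmod (indicator E x * (f x - ?P x) + indicator E x * ?P x))\<^sup>2 \<partial>\<mu>)"
    by (simp add: algebra_simps)
  also have "\<dots> \<le> sqrt (\<integral>x. (cmod (indicator E x * (f x - ?P x)))\<^sup>2 \<partial>\<mu>)
      + sqrt (\<integral>x. (cmod (indicator E x * ?P x))\<^sup>2 \<partial>\<mu>)"
    by (intro L2_triangle Lp_2_indicator d P E)
  also have "\<dots> \<le> \<epsilon>' * sqrt A + sqrt (measure \<mu> E * K * A)"
  proof (intro add_mono)
    have "(\<integral>x. (cmod (indicator E x * (f x - ?P x)))\<^sup>2 \<partial>\<mu>) \<le> (\<integral>x. (cmod (f x - ?P x))\<^sup>2 \<partial>\<mu>)"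
      by (intro integral_mono Lp_2_integrable Lp_2_indicator d E) (auto simp: indicator_def)
    also have "\<dots> \<le> \<epsilon>'\<^sup>2 * A"
      unfolding A_def using f X \<epsilon> concX by (intro norm_diff_projection_concentrated) auto
    finally show "sqrt (\<integral>x. (cmod (indicator E x * (f x - ?P x)))\<^sup>2 \<partial>\<mu>) \<le> \<epsilon>' * sqrt A"
      using \<epsilon> \<open>A > 0\<close> by (intro real_le_lsqrt) (auto simp: power_mult_distrib)
    show "sqrt (\<integral>x. (cmod (indicator E x * ?P x))\<^sup>2 \<partial>\<mu>) \<le> sqrt (measure \<mu> E * K * A)"
      unfolding A_def by (intro real_sqrt_le_mono norm_projection_bound f X E K)
  qed
  finally have "(1 - \<epsilon>) * sqrt A - \<epsilon>' * sqrt A \<le> sqrt (measure \<mu> E * K) * sqrt A"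
    by (simp add: real_sqrt_mult)
  then have "(1 - \<epsilon> - \<epsilon>') * sqrt A \<le> sqrt (measure \<mu> E * K) * sqrt A"
    by (simp add: left_diff_distrib)
  then have "1 - \<epsilon> - \<epsilon>' \<le> sqrt (measure \<mu> E * K)"
    using \<open>A > 0\<close> by simp
  \<comment> \<open>Squaring is legitimate because \<open>\<epsilon> + \<epsilon>' \<le> 1\<close>
    makes the left side nonnegative.\<close>
  then show ?thesis
    using \<epsilon> real_sqrt_ge_0_iff sqrt_ge_absD by fastforce
qed

text \<open>Unit norm excludes it. Used to place \<open>lam 0\<close> in the spectrum and to rule
  out \<open>V = 0\<close>.\<close>

lemma basis_not_AE_0: "\<not> (AE x in \<mu>. e j x = 0)"
proof
  assume "AE x in \<mu>. e j x = 0"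
  then have "L2_inner \<mu> (e j) (e j) = 0"
    unfolding L2_inner_def by (intro integral_eq_zero_AE) auto
  then show False by (simp add: L2_inner_basis)
qed

end

section \<open>The Riemannian volume\<close>

lemma space_chart_volume: "space (chart_volume M c) = topspace (mtop M)"
  by (auto simp: chart_volume_def space_measure_of_conv)

lemma space_riemannian_volume:
  assumes "smooth_manifold M"
  shows "space (riemannian_volume M) = topspace (mtop M)"
proof (cases "atlas M = {}")
  \<comment> \<open>The supremum of no measures has empty space, and a manifold covered by no charts
    is empty too.\<close>
  case True
  then have "topspace (mtop M) = {}"
    using assms by (auto simp: smooth_manifold_def)
  then show ?thesis using True by (simp add: riemannian_volume_def)
next
  case False
  then show ?thesis
    by (subst riemannian_volume_def) (simp add: space_Sup_eq_UN space_chart_volume)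
qed

text \<open>An instance of \<open>uncertainty_principle\<close> with \<open>K\<close> equal to the
  size of \<open>X\<^sub>S\<close> over the volume. It remains to derive finite multiplicities and a
  finite, nonzero volume.\<close>

theorem corollary1p9:
  fixes M :: "('a, 'n::finite) riemannian"
    and e :: "nat \<Rightarrow> 'a \<Rightarrow> complex" and lam :: "nat \<Rightarrow> real"
    and E :: "'a set" and S :: "real set" and f :: "'a \<Rightarrow> complex"
    and L L' \<epsilon> \<epsilon>' :: real
  defines "vol \<equiv> riemannian_volume M"
    and "X\<^sub>S \<equiv> {j. lam j \<in> S}"
  assumes "closed_riemannian_manifold M"
    and "L2_orthonormal_basis vol e"
    and "\<And>j. lam j \<ge> 0"
    and "\<And>j. laplace_eigenfunction M (lam j) (e j)"
    and "lam 0 = 0" and "mono lam" and "filterlim lam at_top sequentially"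
    and "\<And>l. l \<in> sqrt_laplace_spectrum M \<Longrightarrow>
           AE x in vol. (\<Sum>j | lam j = l. (cmod (e j x))\<^sup>2)
             = real (card {j. lam j = l}) / measure vol (topspace (mtop M))"
    and "E \<in> sets vol"
    and "finite S" and "S \<subseteq> sqrt_laplace_spectrum M"
    and "f \<in> Lp 2 vol" and "\<not> (AE x in vol. f x = 0)"
    and "0 \<le> \<epsilon>" and "\<epsilon> < 1" and "0 \<le> \<epsilon>'" and "\<epsilon>' < 1" and "\<epsilon> + \<epsilon>' \<le> 1"
    and "L = (1 - \<epsilon>\<^sup>2) powr (-1/2)" and "L' = (1 - \<epsilon>'\<^sup>2) powr (-1/2)"
    and "Lp_concentrated 2 vol E L f"
    and "Lp_concentrated 2 (count_space UNIV) X\<^sub>S L' (fourier_coeff vol e f)"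
  shows "(1 - \<epsilon> - \<epsilon>')\<^sup>2 \<le> measure vol E / measure vol (topspace (mtop M)) * real (card X\<^sub>S)"
proof -
  interpret L2_basis vol e using assms(4) by (rule L2_basis.intro)
  define V where "V = measure vol (topspace (mtop M))"
  have space: "space vol = topspace (mtop M)"
    using assms(3) by (simp add: vol_def space_riemannian_volume closed_riemannian_manifold_def)
  \<comment> \<open>Multiplicities are finite because \<open>lam\<close> tends to infinity; without
    this, \<open>card\<close> and the sums would take their default value 0.\<close>
  have fin: "finite {j. lam j = l}" for l
  proof -
    have "eventually (\<lambda>j. lam j > l) sequentially"
      using assms(9) by (simp add: filterlim_at_top_dense)
    then obtain N where "\<forall>j\<ge>N. lam j > l" by (auto simp: eventually_sequentially)
    then have "{j. lam j = l} \<subseteq> {..<N}" by (force simp: not_less[symmetric])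
    then show ?thesis by (rule finite_subset) simp
  qed
  \<comment> \<open>If the volume were infinite, \<open>measure\<close> would be \<open>0\<close>, and the assumption on eigenspaces would
    force \<open>e 0\<close> to vanish.\<close>
  have "V \<noteq> 0"
  proof
    assume "V = 0"
    have "lam 0 \<in> sqrt_laplace_spectrum M"
      using assms(5)[of 0] assms(6)[of 0] basis_not_AE_0[of 0]
      unfolding sqrt_laplace_spectrum_def vol_def by blast
    from assms(10)[OF this] have "AE x in vol. (\<Sum>j | lam j = lam 0. (cmod (e j x))\<^sup>2) = 0"
      using \<open>V = 0\<close> by (simp add: V_def)
    then have "AE x in vol. e 0 x = 0"
      by eventually_elim (auto simp: sum_nonneg_eq_0_iff fin)
    then show False using basis_not_AE_0 by blast
  qed
  then have "emeasure vol (space vol) \<noteq> \<infinity>"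
    by (auto simp: V_def measure_def space)
  then interpret finite_measure vol by (rule finite_measureI)
  have XS: "X\<^sub>S = (\<Union>l\<in>S. {j. lam j = l})" by (auto simp: X\<^sub>S_def)
  then have fX: "finite X\<^sub>S" using fin assms(12) by simp
  \<comment> \<open>The exceptional null set depends on the eigenvalue; finiteness of
    \<open>S\<close> permits a common one.\<close>
  have "AE x in vol. \<forall>l\<in>S. (\<Sum>j | lam j = l. (cmod (e j x))\<^sup>2) = real (card {j. lam j = l}) / V"
    using assms(10,12,13) by (subst AE_ball_countable) (auto simp: V_def countable_finite)
  then have K: "AE x in vol. (\<Sum>j\<in>X\<^sub>S. (cmod (e j x))\<^sup>2) \<le> real (card X\<^sub>S) / V"
  proof eventually_elim
    case (elim x)
    \<comment> \<open>Level sets of \<open>lam\<close> for distinct eigenvalues are disjoint, so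
      \<open>X\<^sub>S\<close> splits eigenspace by eigenspace.\<close>
    have "(\<Sum>j\<in>X\<^sub>S. (cmod (e j x))\<^sup>2) = (\<Sum>l\<in>S. \<Sum>j | lam j = l. (cmod (e j x))\<^sup>2)"
      unfolding XS using fin assms(12) by (intro sum.UNION_disjoint) auto
    also have "\<dots> = (\<Sum>l\<in>S. real (card {j. lam j = l})) / V"
      using elim by (simp add: sum_divide_distrib)
    also have "(\<Sum>l\<in>S. real (card {j. lam j = l})) = real (card X\<^sub>S)"
      unfolding XS using fin assms(12) by (subst card_UN_disjoint) auto
    finally show ?case by simp
  qed
  have "(1 - \<epsilon> - \<epsilon>')\<^sup>2 \<le> measure vol E * (real (card X\<^sub>S) / V)"
    by (rule uncertainty_principle[OF assms(14,15) fX assms(11) _ K assms(16-20)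
          assms(23,24)[unfolded assms(21,22)]]) (simp add: less_top[symmetric])
  then show ?thesis by (simp add: V_def)
qed

end
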